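(* An almost paracontact metric 3-dimensional Walker manifold $(M,\varphi,\xi,\eta,g)$ for which $\xi_2=0$ is paracontact metric if and only if $$\xi_3=e^{-2y+\psi(z)}\quad\text{and}\quad f=2\psi'(z)\,x+m(z),$$ where $x,y,z$ are the local coordinates of $M$ and $\psi=\psi(z)$, $m=m(z)$ are smooth functions on $M$ depending only on $z$.
   Context: An almost paracontact metric 3-dimensional Walker manifold $(M,\varphi,\xi,\eta,g)$ is a 3-manifold with coordinates $(x,y,z)$, $f\in C^\infty(M)$, and, with respect to $\{\partial_x,\partial_y,\partial_z\}$, $$g=\begin{pmatrix}0&0&1\\0&1&0\\1&0&f\end{pmatrix},\quad \varphi=\begin{pmatrix}-\xi_2&\xi_1+f\xi_3&-f\xi_2\\ \xi_3&0&-\xi_1\\0&-\xi_3&\xi_2\end{pmatrix},$$ $\xi=\xi_1\partial_x+\xi_2\partial_y+\xi_3\partial_z$, $\eta=\xi_3dx+\xi_2dy+(\xi_1+f\xi_3)dz$, where $\xi_1,\xi_2,\xi_3\in C^\infty(M)$ satisfy $\xi_2^2+f\xi_3^2+2\xi_1\xi_3=1$ (columns of $\varphi$ are the images of the basis vectors). Let $\phi(X,Y)=g(\varphi X,Y)$ and $d\eta(X,Y)=\frac12((\nabla_X\eta)Y-(\nabla_Y\eta)X)$, $\nabla$ the Levi-Civita connection. The manifold is paracontact metric if $\phi=d\eta$.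
   Formalization: As ξ→−ξ preserves φ=dη, ξ₃=−e^{−2y+ψ(z)} also occurs: the printed form is proved for ξ₃>0, otherwise with a sign ±. Global ψ(z), m(z) need M to have connected slices z=const (and M connected for a global sign); for general M the equivalence is local, near each point. *)

theory Defs
  imports "HOL-Analysis.Analysis"
begin

primrec Ck_on :: "nat \<Rightarrow> ('a::real_normed_vector) set \<Rightarrow> ('a \<Rightarrow> real) \<Rightarrow> bool" where
  "Ck_on 0 U h \<longleftrightarrow> continuous_on U h"
| "Ck_on (Suc n) U h \<longleftrightarrow>
     (\<forall>p\<in>U. h differentiable (at p)) \<and>
     (\<forall>v. Ck_on n U (\<lambda>p. frechet_derivative h (at p) v))"

text \<open>Intended for open sets only.\<close>

definition smooth_on :: "('a::real_normed_vector) set \<Rightarrow> ('a \<Rightarrow> real) \<Rightarrow> bool" where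
  "smooth_on U h \<longleftrightarrow> (\<forall>n. Ck_on n U h)"

text \<open>Points of \<^typ>\<open>real^3\<close> are coordinate triples: the coordinates \<open>x, y, z\<close> of \<open>p\<close>
  are \<open>p $ 1, p $ 2, p $ 3\<close>. Tangent vectors are identified with \<^typ>\<open>real^3\<close> through the
  coordinate frame, so that a tensor field is given by its components.\<close>

definition partial :: "3 \<Rightarrow> (real^3 \<Rightarrow> real) \<Rightarrow> real^3 \<Rightarrow> real" where
  "partial i h p = frechet_derivative h (at p) (axis i 1)"

text \<open>Levi-Civita connection of a metric \<open>G\<close>, given by
  \<open>\<nabla>\<^bsub>\<partial>i\<^esub> \<partial>j = (\<Sum>k. christoffel G k i j \<partial>k)\<close>.\<close>

definition christoffel :: "(real^3 \<Rightarrow> real^3^3) \<Rightarrow> 3 \<Rightarrow> 3 \<Rightarrow> 3 \<Rightarrow> real^3 \<Rightarrow> real" where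
  "christoffel G k i j p =
     (1/2) * (\<Sum>l\<in>UNIV. matrix_inv (G p) $ k $ l *
        (partial i (\<lambda>q. G q $ j $ l) p + partial j (\<lambda>q. G q $ i $ l) p
          - partial l (\<lambda>q. G q $ i $ j) p))"

lemma christoffel_torsion_free:
  assumes "\<And>q. transpose (G q) = G q"
  shows "christoffel G k i j p = christoffel G k j i p"
proof -
  have "G q $ a $ b = G q $ b $ a" for q a b
    using arg_cong[OF assms[of q], of "\<lambda>A. A $ a $ b"] by (simp add: transpose_def)
  then have "(\<lambda>q. G q $ i $ j) = (\<lambda>q. G q $ j $ i)" by auto
  then show ?thesis
    by (simp add: christoffel_def add.commute)
qed

lemma christoffel_metric:
  assumes sym: "\<And>q. transpose (G q) = G q" and inv: "invertible (G p)"
  shows "partial i (\<lambda>q. G q $ j $ k) p =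
    (\<Sum>l\<in>UNIV. christoffel G l i j p * G p $ l $ k)
    + (\<Sum>l\<in>UNIV. christoffel G l i k p * G p $ j $ l)"
proof -
  have s: "G q $ a $ b = G q $ b $ a" for q a b
    using arg_cong[OF sym[of q], of "\<lambda>A. A $ a $ b"] by (simp add: transpose_def)
  have sp: "partial c (\<lambda>q. G q $ a $ b) p = partial c (\<lambda>q. G q $ b $ a) p" for a b c
  proof -
    have "(\<lambda>q. G q $ a $ b) = (\<lambda>q. G q $ b $ a)" using s by blast
    then show ?thesis by simp
  qed
  have I: "(\<Sum>l\<in>UNIV. G p $ b $ l * matrix_inv (G p) $ l $ a) = (if b = a then 1 else 0)" for a b
  proof -
    have "G p ** matrix_inv (G p) = mat 1"
      using someI_ex[OF inv[unfolded invertible_def]] unfolding matrix_inv_def by blast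
    then have "(G p ** matrix_inv (G p)) $ b $ a = (mat 1 :: real^3^3) $ b $ a"
      by simp
    then show ?thesis by (simp add: matrix_matrix_mult_def mat_def)
  qed
  define T where "T a b l = partial a (\<lambda>q. G q $ b $ l) p + partial b (\<lambda>q. G q $ a $ l) p
          - partial l (\<lambda>q. G q $ a $ b) p" for a b l
  have L: "(\<Sum>l\<in>UNIV. G p $ c $ l * christoffel G l a b p) = (1/2) * T a b c" for a b c
  proof -
    have "(\<Sum>l\<in>UNIV. G p $ c $ l * christoffel G l a b p)
        = (\<Sum>l\<in>UNIV. \<Sum>n\<in>UNIV. (1/2) * T a b n * (G p $ c $ l * matrix_inv (G p) $ l $ n))"
      unfolding christoffel_def T_def[symmetric] by (simp add: sum_distrib_left algebra_simps)
    also have "\<dots> = (\<Sum>n\<in>UNIV. (1/2) * T a b n * (\<Sum>l\<in>UNIV. G p $ c $ l * matrix_inv (G p) $ l $ n))"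
      by (subst sum.swap) (simp add: sum_distrib_left)
    also have "\<dots> = (1/2) * T a b c"
      by (simp add: I if_distrib cong: if_cong)
    finally show ?thesis .
  qed
  have "(\<Sum>l\<in>UNIV. christoffel G l i j p * G p $ l $ k) = (1/2) * T i j k"
  proof -
    have "christoffel G l i j p * G p $ l $ k = G p $ k $ l * christoffel G l i j p" for l
      using s[of p l k] by (simp only: mult.commute)
    then show ?thesis using L[of k i j] by (simp only:)
  qed
  moreover have "(\<Sum>l\<in>UNIV. christoffel G l i k p * G p $ j $ l) = (1/2) * T i k j"
    using L[of j i k] by (simp add: mult.commute)
  ultimately show ?thesis
    unfolding T_def using sp[of i j k] sp[of k i j] sp[of j i k] by simp
qed

text \<open>\<open>(\<nabla>\<^bsub>X\<^esub> \<omega>) Y\<close> at \<open>p\<close>, for a one-form \<open>\<omega>\<close> given by its components.\<close>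

definition cov_deriv_form ::
    "(real^3 \<Rightarrow> real^3^3) \<Rightarrow> (real^3 \<Rightarrow> real^3) \<Rightarrow> real^3 \<Rightarrow> real^3 \<Rightarrow> real^3 \<Rightarrow> real" where
  "cov_deriv_form G \<omega> p X Y =
     (\<Sum>i\<in>UNIV. \<Sum>j\<in>UNIV. X $ i * Y $ j *
        (partial i (\<lambda>q. \<omega> q $ j) p - (\<Sum>k\<in>UNIV. christoffel G k i j p * \<omega> p $ k)))"

definition ext_deriv ::
    "(real^3 \<Rightarrow> real^3^3) \<Rightarrow> (real^3 \<Rightarrow> real^3) \<Rightarrow> real^3 \<Rightarrow> real^3 \<Rightarrow> real^3 \<Rightarrow> real" where
  "ext_deriv G \<omega> p X Y = (1/2) * (cov_deriv_form G \<omega> p X Y - cov_deriv_form G \<omega> p Y X)"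

definition walker_metric :: "(real^3 \<Rightarrow> real) \<Rightarrow> real^3 \<Rightarrow> real^3^3" where
  "walker_metric f p = vector [vector [0, 0, 1], vector [0, 1, 0], vector [1, 0, f p]]"

text \<open>The \<open>j\<close>-th column holds the components of the image of the \<open>j\<close>-th coordinate vector,
  so the tensor acts by \<open>(*v)\<close>.\<close>

definition walker_phi ::
    "(real^3 \<Rightarrow> real) \<Rightarrow> (real^3 \<Rightarrow> real) \<Rightarrow> (real^3 \<Rightarrow> real) \<Rightarrow> (real^3 \<Rightarrow> real) \<Rightarrow> real^3 \<Rightarrow> real^3^3"
where
  "walker_phi f \<xi>1 \<xi>2 \<xi>3 p = vector
     [vector [- \<xi>2 p, \<xi>1 p + f p * \<xi>3 p, - (f p * \<xi>2 p)],
      vector [\<xi>3 p, 0, - \<xi>1 p],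
      vector [0, - \<xi>3 p, \<xi>2 p]]"

definition walker_eta ::
    "(real^3 \<Rightarrow> real) \<Rightarrow> (real^3 \<Rightarrow> real) \<Rightarrow> (real^3 \<Rightarrow> real) \<Rightarrow> (real^3 \<Rightarrow> real) \<Rightarrow> real^3 \<Rightarrow> real^3"
where
  "walker_eta f \<xi>1 \<xi>2 \<xi>3 p = vector [\<xi>3 p, \<xi>2 p, \<xi>1 p + f p * \<xi>3 p]"

definition almost_paracontact_walker ::
    "(real^3) set \<Rightarrow> (real^3 \<Rightarrow> real) \<Rightarrow> (real^3 \<Rightarrow> real) \<Rightarrow> (real^3 \<Rightarrow> real) \<Rightarrow> (real^3 \<Rightarrow> real) \<Rightarrow> bool"
where
  "almost_paracontact_walker M f \<xi>1 \<xi>2 \<xi>3 \<longleftrightarrow>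
     open M \<and> smooth_on M f \<and> smooth_on M \<xi>1 \<and> smooth_on M \<xi>2 \<and> smooth_on M \<xi>3 \<and>
     (\<forall>p\<in>M. (\<xi>2 p)\<^sup>2 + f p * (\<xi>3 p)\<^sup>2 + 2 * \<xi>1 p * \<xi>3 p = 1)"

definition fundamental_form ::
    "(real^3 \<Rightarrow> real) \<Rightarrow> (real^3 \<Rightarrow> real) \<Rightarrow> (real^3 \<Rightarrow> real) \<Rightarrow> (real^3 \<Rightarrow> real) \<Rightarrow>
     real^3 \<Rightarrow> real^3 \<Rightarrow> real^3 \<Rightarrow> real"
where
  "fundamental_form f \<xi>1 \<xi>2 \<xi>3 p X Y = (walker_phi f \<xi>1 \<xi>2 \<xi>3 p *v X) \<bullet> (walker_metric f p *v Y)"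

definition paracontact_metric ::
    "(real^3) set \<Rightarrow> (real^3 \<Rightarrow> real) \<Rightarrow> (real^3 \<Rightarrow> real) \<Rightarrow> (real^3 \<Rightarrow> real) \<Rightarrow> (real^3 \<Rightarrow> real) \<Rightarrow> bool"
where
  "paracontact_metric M f \<xi>1 \<xi>2 \<xi>3 \<longleftrightarrow>
     (\<forall>p\<in>M. \<forall>X Y. fundamental_form f \<xi>1 \<xi>2 \<xi>3 p X Y =
        ext_deriv (walker_metric f) (walker_eta f \<xi>1 \<xi>2 \<xi>3) p X Y)"

text \<open>A function on \<open>U\<close> depending only on \<open>z\<close> is a function on the image of \<open>U\<close> under \<open>z\<close>.
  The sign \<open>\<epsilon>\<close> cannot be avoided: replacing \<open>\<xi>\<close> by \<open>- \<xi>\<close> replaces \<open>\<phi>\<close> and \<open>\<eta>\<close> by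
  their negatives, which preserves the paracontact metric condition.\<close>

definition signed_normal_form ::
    "real \<Rightarrow> (real^3) set \<Rightarrow> (real^3 \<Rightarrow> real) \<Rightarrow> (real^3 \<Rightarrow> real) \<Rightarrow> bool" where
  "signed_normal_form \<epsilon> U f \<xi>3 \<longleftrightarrow>
     (\<exists>\<psi> m. smooth_on ((\<lambda>p. p $ 3) ` U) \<psi> \<and> smooth_on ((\<lambda>p. p $ 3) ` U) m \<and>
       (\<forall>p\<in>U. \<xi>3 p = \<epsilon> * exp (- 2 * p $ 2 + \<psi> (p $ 3)) \<and>
              f p = 2 * deriv \<psi> (p $ 3) * p $ 1 + m (p $ 3)))"

text \<open>The condition under which a function on an open \<open>M\<close> with vanishing \<open>x\<close>- and
  \<open>y\<close>-derivatives is globally a function of \<open>z\<close>; it holds for boxes and convex sets.\<close>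

definition z_slices_connected :: "(real^3) set \<Rightarrow> bool" where
  "z_slices_connected M \<longleftrightarrow> (\<forall>c. connected {p\<in>M. p $ 3 = c})"

end

theory Submission
  imports Defs
begin

text \<open>Since \<open>\<nabla>\<close> is torsion-free, \<open>d\<eta>\<close> has components \<open>(\<partial>\<^sub>i \<eta>\<^sub>j - \<partial>\<^sub>j \<eta>\<^sub>i) / 2\<close>. Eliminating the derivatives
  of \<open>\<xi>1\<close> through the constraint \<open>f \<xi>3\<^sup>2 + 2 \<xi>1 \<xi>3 = 1\<close>, the paracontact metric condition becomes
  \<open>\<partial>\<^sub>y \<xi>3 = - 2 \<xi>3\<close>, \<open>\<partial>\<^sub>y f = 0\<close> and \<open>\<xi>3\<^sup>2 \<partial>\<^sub>x f - 2 \<xi>1 \<partial>\<^sub>x \<xi>3 = 2 \<xi>3 \<partial>\<^sub>z \<xi>3\<close>. The first two determine the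
  dependence of every term of the third on \<open>y\<close>, and comparing exponentials gives \<open>\<partial>\<^sub>x \<xi>3 = 0\<close>. Hence
  \<open>ln \<bar>\<xi>3\<bar> + 2 y\<close> is a function \<open>\<psi>\<close> of \<open>z\<close>, the third equation reads \<open>\<partial>\<^sub>x f = 2 \<psi>'\<close>, and
  \<open>f - 2 \<psi>' x\<close> is a function of \<open>z\<close>.\<close>

section \<open>Calculus of smooth functions\<close>

text \<open>On an open set a Frechet derivative depends only on nearby values, so agreement on
  \<open>U\<close> passes to all derivatives there. The functions are generalised because the
  induction moves on to the derivatives.\<close>

lemma Ck_on_cong:
  assumes "open U" "\<And>p. p \<in> U \<Longrightarrow> g p = h p" "Ck_on n U g"
  shows "Ck_on n U h"
  using assms(2,3)
proof (induction n arbitrary: g h)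
  case 0
  then show ?case using continuous_on_cong by (metis Ck_on.simps(1))
next
  case (Suc n)
  have D: "(h has_derivative frechet_derivative g (at p)) (at p)" if "p \<in> U" for p
    using Suc.prems that has_derivative_transform_within_open[of g _ p UNIV U h] \<open>open U\<close>
    by (auto simp: frechet_derivative_works)
  then have "frechet_derivative h (at p) = frechet_derivative g (at p)" if "p \<in> U" for p
    using that frechet_derivative_at by metis
  moreover have "h differentiable (at p)" if "p \<in> U" for p
    using D that by (auto simp: differentiable_def)
  ultimately show ?case
    using Suc.prems(2) Suc.IH[of "\<lambda>p. frechet_derivative g (at p) v" "\<lambda>p. frechet_derivative h (at p) v" for v]
    by simp
qed

text \<open>Lets any explicit derivative \<open>D\<close> replace the choice made by
  \<open>frechet_derivative\<close>; the closure rules below feed it the usual differentiation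
  rules.\<close>

lemma Ck_on_SucI:
  assumes "open U" "\<And>p. p \<in> U \<Longrightarrow> (h has_derivative D p) (at p)"
    and "\<And>v. Ck_on n U (\<lambda>p. D p v)"
  shows "Ck_on (Suc n) U h"
proof -
  have "frechet_derivative h (at p) = D p" if "p \<in> U" for p
    using assms(2)[OF that] frechet_derivative_at by metis
  then have "Ck_on n U (\<lambda>p. frechet_derivative h (at p) v)" for v
    by (intro Ck_on_cong[OF assms(1) _ assms(3)[of v]]) simp
  then show ?thesis using assms(2) by (auto simp: differentiable_def)
qed

text \<open>For the product and chain rules below: they reproduce undifferentiated factors, which
  must be lowered by one order to match the derivatives.\<close>

lemma Ck_on_SucD:
  assumes "Ck_on (Suc n) U h"
  shows "Ck_on n U h"
  using assms
proof (induction n arbitrary: h)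
  case 0
  then show ?case
    by (simp add: continuous_on_eq_continuous_within differentiable_imp_continuous_within
        differentiable_at_withinI)
next
  case (Suc n)
  then show ?case using Ck_on.simps(2) by blast
qed

lemma Ck_on_has_derivative:
  "Ck_on (Suc n) U h \<Longrightarrow> p \<in> U \<Longrightarrow> (h has_derivative frechet_derivative h (at p)) (at p)"
  by (simp add: frechet_derivative_works)

lemma Ck_on_subset:
  assumes "Ck_on n U h" "V \<subseteq> U"
  shows "Ck_on n V h"
  using assms(1)
  by (induction n arbitrary: h) (use assms(2) continuous_on_subset in \<open>auto simp: subset_iff\<close>)

lemma Ck_on_const: "open U \<Longrightarrow> Ck_on n U (\<lambda>_. c)"
proof (induction n arbitrary: c)
  case (Suc n)
  show ?case
    by (rule Ck_on_SucI[OF Suc.prems has_derivative_const Suc.IH[OF Suc.prems]])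
qed simp

lemma Ck_on_linear:
  assumes "open U" "bounded_linear L"
  shows "Ck_on n U L"
proof (cases n)
  case 0
  then show ?thesis using assms by (simp add: linear_continuous_on)
next
  case (Suc k)
  show ?thesis unfolding Suc
    by (rule Ck_on_SucI[OF assms(1) bounded_linear_imp_has_derivative[OF assms(2)]
          Ck_on_const[OF assms(1)]])
qed

lemma Ck_on_add:
  assumes "open U" "Ck_on n U g" "Ck_on n U h"
  shows "Ck_on n U (\<lambda>p. g p + h p)"
  using assms(2,3)
proof (induction n arbitrary: g h)
  case (Suc n)
  show ?case
    by (rule Ck_on_SucI[OF assms(1) has_derivative_add[OF Ck_on_has_derivative[OF Suc.prems(1)]
            Ck_on_has_derivative[OF Suc.prems(2)]]])
      (use Suc in auto)
qed (simp add: continuous_on_add)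

lemma Ck_on_mult:
  assumes "open U" "Ck_on n U g" "Ck_on n U h"
  shows "Ck_on n U (\<lambda>p. g p * h p)"
  using assms(2,3)
proof (induction n arbitrary: g h)
  case (Suc n)
  show ?case
    by (rule Ck_on_SucI[OF assms(1) has_derivative_mult[OF Ck_on_has_derivative[OF Suc.prems(1)]
            Ck_on_has_derivative[OF Suc.prems(2)]]])
      (use Suc Ck_on_SucD[OF Suc.prems(1)] Ck_on_SucD[OF Suc.prems(2)] in
        \<open>auto intro!: Ck_on_add[OF assms(1)]\<close>)
qed (simp add: continuous_on_mult)

lemma Ck_on_inverse:
  assumes "open U" "Ck_on n U h" "\<And>p. p \<in> U \<Longrightarrow> h p \<noteq> 0"
  shows "Ck_on n U (\<lambda>p. inverse (h p))"
  using assms(2,3)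
proof (induction n arbitrary: h)
  case (Suc n)
  have I: "Ck_on n U (\<lambda>p. inverse (h p))"
    using Suc.IH Ck_on_SucD Suc.prems by blast
  \<comment> \<open>The derivative of the reciprocal contains the reciprocal itself, which has order
    \<open>n\<close> by the induction hypothesis for the same \<open>h\<close>.\<close>
  have "Ck_on n U (\<lambda>p. (- 1) * (inverse (h p) * frechet_derivative h (at p) v * inverse (h p)))"
    for v using Suc.prems(1) by (intro Ck_on_mult[OF assms(1)] I Ck_on_const[OF assms(1)]) simp
  then show ?case
    by (intro Ck_on_SucI[OF assms(1) Deriv.has_derivative_inverse
            [OF Suc.prems(2) Ck_on_has_derivative[OF Suc.prems(1)]]]) auto
qed (simp add: continuous_on_inverse)

text \<open>A case split replaces induction: the derivative of \<open>ln\<close> after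
  \<open>h\<close> is that of \<open>h\<close> times \<open>inverse (h p)\<close>, where no
  logarithm remains.\<close>

lemma Ck_on_ln:
  assumes "open U" "Ck_on n U h" "\<And>p. p \<in> U \<Longrightarrow> h p > 0"
  shows "Ck_on n U (\<lambda>p. ln (h p))"
proof (cases n)
  case 0
  then show ?thesis using assms by (force intro: continuous_on_ln)
next
  case (Suc k)
  have "Ck_on k U (\<lambda>p. inverse (h p))"
    using Ck_on_inverse[OF assms(1)] assms(2,3) Ck_on_SucD Suc by (metis less_irrefl)
  then have "Ck_on k U (\<lambda>p. frechet_derivative h (at p) v * inverse (h p))" for v
    using assms(2) Suc by (intro Ck_on_mult[OF assms(1)]) auto
  moreover have "((\<lambda>q. ln (h q)) has_derivative
      (\<lambda>v. frechet_derivative h (at p) v * inverse (h p))) (at p)" if "p \<in> U" for p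
    using has_derivative_ln[OF assms(3)[OF that] Ck_on_has_derivative[OF assms(2)[unfolded Suc] that]]
    by (simp add: divide_inverse)
  ultimately show ?thesis
    unfolding Suc by (intro Ck_on_SucI[OF assms(1)])
qed

lemma smooth_on_differentiable: "smooth_on U h \<Longrightarrow> p \<in> U \<Longrightarrow> h differentiable (at p)"
  unfolding smooth_on_def by (metis Ck_on.simps(2))

lemma smooth_on_frechet_derivative:
  "smooth_on U h \<Longrightarrow> smooth_on U (\<lambda>p. frechet_derivative h (at p) v)"
  unfolding smooth_on_def by (metis Ck_on.simps(2))

lemma smooth_on_subset: "smooth_on U h \<Longrightarrow> V \<subseteq> U \<Longrightarrow> smooth_on V h"
  unfolding smooth_on_def using Ck_on_subset by blast

lemma smooth_on_cong:
  "smooth_on U g \<Longrightarrow> open U \<Longrightarrow> (\<And>p. p \<in> U \<Longrightarrow> g p = h p) \<Longrightarrow> smooth_on U h"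
  unfolding smooth_on_def using Ck_on_cong by blast

section \<open>Partial derivatives along coordinate lines\<close>

lemma has_derivative_line:
  assumes "h differentiable (at (p + t *\<^sub>R v))"
  shows "((\<lambda>t. h (p + t *\<^sub>R v)) has_real_derivative frechet_derivative h (at (p + t *\<^sub>R v)) v) (at t)"
proof -
  let ?D = "frechet_derivative h (at (p + t *\<^sub>R v))"
  have h: "(h has_derivative ?D) (at (p + t *\<^sub>R v))"
    using assms by (simp add: frechet_derivative_works)
  have "((\<lambda>t. p + t *\<^sub>R v) has_derivative (\<lambda>s. s *\<^sub>R v)) (at t)"
    by (auto intro!: derivative_eq_intros)
  from has_derivative_compose[OF this h]
  have "((\<lambda>t. h (p + t *\<^sub>R v)) has_derivative (\<lambda>s. ?D (s *\<^sub>R v))) (at t)" .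
  moreover have "?D (s *\<^sub>R v) = ?D v * s" for s
    using linear_cmul[OF has_derivative_linear[OF h]] by simp
  ultimately show ?thesis
    unfolding has_field_derivative_def by simp
qed

lemma has_derivative_coordinate_line:
  "h differentiable (at (p + t *\<^sub>R axis i 1)) \<Longrightarrow>
    ((\<lambda>t. h (p + t *\<^sub>R axis i 1)) has_real_derivative partial i h (p + t *\<^sub>R axis i 1)) (at t)"
  unfolding partial_def by (rule has_derivative_line)

lemma open_line_eventually:
  fixes p v :: "'a::real_normed_vector"
  assumes "open U" "p \<in> U"
  shows "eventually (\<lambda>t. p + t *\<^sub>R v \<in> U) (nhds (0::real))"
proof -
  have "((\<lambda>t. p + t *\<^sub>R v) \<longlongrightarrow> p + 0 *\<^sub>R v) (nhds (0::real))"
    by (intro tendsto_intros filterlim_ident)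
  then show ?thesis using assms topological_tendstoD by fastforce
qed

text \<open>Reduces a partial derivative to one-variable calculus. Since \<open>partial\<close>
  comes from the Frechet derivative, differentiability at \<open>p\<close> is what ties it to the
  restriction to the coordinate line; the formula \<open>g\<close> is only required where that line
  lies in \<open>U\<close>.\<close>

lemma partial_eqI:
  assumes "open U" "p \<in> U" "h differentiable (at p)"
    and "\<And>t. p + t *\<^sub>R axis i 1 \<in> U \<Longrightarrow> h (p + t *\<^sub>R axis i 1) = g t"
    and "(g has_real_derivative d) (at 0)"
  shows "partial i h p = d"
proof -
  have "((\<lambda>t. h (p + t *\<^sub>R axis i 1)) has_real_derivative partial i h p) (at 0)"
    using has_derivative_coordinate_line[of h p 0 i] assms(3) by simp
  moreover have "((\<lambda>t. h (p + t *\<^sub>R axis i 1)) has_real_derivative d) (at 0)"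
    by (subst DERIV_cong_ev[OF refl eventually_mono[OF open_line_eventually[OF assms(1,2)] assms(4)] refl])
      (use assms(5) in simp_all)
  ultimately show ?thesis by (rule DERIV_unique)
qed

lemma partial_const_on:
  "open U \<Longrightarrow> p \<in> U \<Longrightarrow> h differentiable (at p) \<Longrightarrow> (\<And>q. q \<in> U \<Longrightarrow> h q = c) \<Longrightarrow> partial i h p = 0"
  by (rule partial_eqI[of U p h i "\<lambda>_. c"]) auto

lemma partial_add:
  assumes "g differentiable (at p)" "h differentiable (at p)"
  shows "partial i (\<lambda>q. g q + h q) p = partial i g p + partial i h p"
  by (rule partial_eqI[of UNIV])
    (use assms has_derivative_coordinate_line[of g p 0 i] has_derivative_coordinate_line[of h p 0 i]
      in \<open>auto intro!: DERIV_add\<close>)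

lemma partial_mult:
  assumes "g differentiable (at p)" "h differentiable (at p)"
  shows "partial i (\<lambda>q. g q * h q) p = partial i g p * h p + g p * partial i h p"
proof (rule partial_eqI[of UNIV _ _ _ "\<lambda>t. g (p + t *\<^sub>R axis i 1) * h (p + t *\<^sub>R axis i 1)"])
  show "((\<lambda>t. g (p + t *\<^sub>R axis i 1) * h (p + t *\<^sub>R axis i 1)) has_real_derivative
      partial i g p * h p + g p * partial i h p) (at 0)"
    using DERIV_mult[OF has_derivative_coordinate_line[of g p 0 i]
        has_derivative_coordinate_line[of h p 0 i]] assms
    by (simp add: algebra_simps)
qed (use assms in auto)

lemma frechet_derivative_partial:
  assumes "h differentiable (at p)"
  shows "frechet_derivative h (at p) v = (\<Sum>i\<in>UNIV. v $ i * partial i h p)"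
proof -
  have lin: "linear (frechet_derivative h (at p))"
    using assms by (simp add: linear_frechet_derivative)
  have "frechet_derivative h (at p) v = frechet_derivative h (at p) (\<Sum>i\<in>UNIV. v $ i *\<^sub>R axis i 1)"
    by (simp add: basis_expansion flip: scalar_mult_eq_scaleR)
  also have "\<dots> = (\<Sum>i\<in>UNIV. v $ i * partial i h p)"
    by (simp add: linear_sum[OF lin] linear_cmul[OF lin] partial_def)
  finally show ?thesis .
qed

section \<open>Functions of the last coordinate\<close>

text \<open>\<open>F\<close> is locally constant on a slice: two of its points in a small ball are
  joined by a segment inside the slice and the ball, along which the derivative vanishes.
  Connectedness of the slice makes this global.\<close>

lemma constant_on_z_slices:
  fixes F :: "real^3 \<Rightarrow> real"
  assumes "open M" "z_slices_connected M" "\<And>p. p \<in> M \<Longrightarrow> F differentiable (at p)"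
    and "\<And>p. p \<in> M \<Longrightarrow> partial 1 F p = 0" "\<And>p. p \<in> M \<Longrightarrow> partial 2 F p = 0"
    and "p \<in> M" "q \<in> M" "p $ 3 = q $ 3"
  shows "F p = F q"
proof -
  define S where "S = {r \<in> M. r $ 3 = p $ 3}"
  have "connected S" using assms(2) by (simp add: S_def z_slices_connected_def)
  moreover have "eventually (\<lambda>r. F a = F r) (at a within S)" if "a \<in> S" for a
  proof -
    obtain d where d: "d > 0" "ball a d \<subseteq> M"
      using \<open>a \<in> S\<close> assms(1) by (auto simp: S_def open_contains_ball)
    have "F a = F r" if r: "r \<in> ball a d" "r \<in> S" for r
    proof -
      have "((\<lambda>t. F (a + t *\<^sub>R (r - a))) has_real_derivative 0) (at t within {0..1})"
        if "t \<in> {0..1}" for t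
      proof -
        have "a + t *\<^sub>R (r - a) \<in> ball a d"
          using convexD_alt[OF convex_ball, of a a d r t] r(1) d(1) that
          by (simp add: algebra_simps)
        then have *: "a + t *\<^sub>R (r - a) \<in> M" using d(2) by blast
        \<comment> \<open>The direction \<open>r - a\<close> has third component 0, so only the two
          vanishing partial derivatives enter.\<close>
        have "frechet_derivative F (at (a + t *\<^sub>R (r - a))) (r - a) = 0"
          using r(2) \<open>a \<in> S\<close> by (simp add: frechet_derivative_partial[OF assms(3)[OF *]] sum_3
              assms(4,5)[OF *] S_def)
        then show ?thesis
          using has_derivative_line[of F a t "r - a"] assms(3)[OF *]
          by (metis has_field_derivative_at_within)
      qed
      then obtain c where "\<And>t. t \<in> {0..1} \<Longrightarrow> F (a + t *\<^sub>R (r - a)) = c"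
        using has_field_derivative_zero_constant[of "{0..1}" "\<lambda>t. F (a + t *\<^sub>R (r - a))"] by auto
      from this[of 0] this[of 1] show ?thesis by simp
    qed
    moreover have "eventually (\<lambda>r. r \<in> ball a d \<and> r \<in> S) (at a within S)"
      using d(1) eventually_at_ball[of d a S] by (auto elim: eventually_mono)
    ultimately show ?thesis by (auto elim: eventually_mono)
  qed
  ultimately show ?thesis
    using connected_local_const[of S p q F] assms(6-8) by (simp add: S_def)
qed

section \<open>Descent of smoothness from \<open>M\<close> to its image under the last
  coordinate\<close>

lemma z_has_derivative:
  assumes "(\<lambda>q::real^3. \<psi> (q $ 3)) differentiable (at p)"
  shows "(\<psi> has_real_derivative partial 3 (\<lambda>q. \<psi> (q $ 3)) p) (at (p $ 3))"
proof -
  have "((\<lambda>t. \<psi> (p $ 3 + t)) has_real_derivative partial 3 (\<lambda>q. \<psi> (q $ 3)) p) (at 0)"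
    using has_derivative_coordinate_line[of "\<lambda>q. \<psi> (q $ 3)" p 0 3] assms by simp
  then show ?thesis
    using DERIV_shift[of \<psi> _ 0 "p $ 3"] by (simp add: add.commute)
qed

text \<open>Through every point of \<open>M\<close> the line in direction \<open>axis 3 1\<close> is
  an affine section of the projection to \<open>z\<close>, so regularity passes to
  \<open>\<psi>\<close>. The pullback of \<open>deriv \<psi>\<close> is the third partial derivative
  of the pullback of \<open>\<psi>\<close>, which makes the induction go through.\<close>

lemma Ck_on_z_descend:
  fixes M :: "(real^3) set"
  assumes "open M" "Ck_on n M (\<lambda>p. \<psi> (p $ 3))"
  shows "Ck_on n ((\<lambda>p. p $ 3) ` M) \<psi>"
  using assms(2)
proof (induction n arbitrary: \<psi>)
  case 0
  have "isCont \<psi> (p $ 3)" if "p \<in> M" for p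
  proof -
    have "isCont (\<lambda>q. \<psi> (q $ 3)) p"
      using 0 that assms(1) by (simp add: continuous_on_eq_continuous_at)
    moreover have "isCont (\<lambda>t. p + (t - p $ 3) *\<^sub>R axis 3 1) (p $ 3)"
      by (intro continuous_intros)
    ultimately have "isCont (\<lambda>t. \<psi> ((p + (t - p $ 3) *\<^sub>R axis 3 1) $ 3)) (p $ 3)"
      using isCont_o2[of "p $ 3" "\<lambda>t. p + (t - p $ 3) *\<^sub>R axis 3 1" "\<lambda>q. \<psi> (q $ 3)"] by simp
    then show ?thesis by simp
  qed
  then show ?case
    by (auto simp: continuous_at_imp_continuous_on)
next
  case (Suc n)
  let ?D = "\<lambda>p. partial 3 (\<lambda>q. \<psi> (q $ 3)) p"
  have D: "(\<psi> has_real_derivative ?D p) (at (p $ 3))" if "p \<in> M" for p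
    using Suc.prems that by (intro z_has_derivative) auto
  have "(\<psi> has_derivative (\<lambda>v. deriv \<psi> c * v)) (at c)" if "c \<in> (\<lambda>p. p $ 3) ` M" for c
    using D DERIV_imp_deriv[OF D] that by (auto simp: has_field_derivative_def)
  moreover have "Ck_on n ((\<lambda>p. p $ 3) ` M) (\<lambda>c. deriv \<psi> c * v)" for v
  proof (rule Suc.IH)
    have "Ck_on n M ?D" using Suc.prems by (simp add: partial_def)
    then have "Ck_on n M (\<lambda>p. ?D p * v)"
      by (intro Ck_on_mult[OF assms(1)] Ck_on_const[OF assms(1)])
    then show "Ck_on n M (\<lambda>p. deriv \<psi> (p $ 3) * v)"
      by (rule Ck_on_cong[OF assms(1), rotated]) (simp add: DERIV_imp_deriv[OF D])
  qed
  ultimately show ?case by (rule Ck_on_SucI[OF open_image_vec_nth[OF assms(1)]])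
qed

lemma smooth_function_of_z:
  fixes F :: "real^3 \<Rightarrow> real"
  assumes "open M" "z_slices_connected M" "smooth_on M F"
    and "\<And>p. p \<in> M \<Longrightarrow> partial 1 F p = 0" "\<And>p. p \<in> M \<Longrightarrow> partial 2 F p = 0"
  obtains \<psi> where "smooth_on ((\<lambda>p. p $ 3) ` M) \<psi>" "\<And>p. p \<in> M \<Longrightarrow> F p = \<psi> (p $ 3)"
    "\<And>p. p \<in> M \<Longrightarrow> deriv \<psi> (p $ 3) = partial 3 F p"
proof -
  \<comment> \<open>Any representative of the slice will do, since \<open>F\<close> is constant on
    it.\<close>
  define \<psi> where "\<psi> c = F (SOME q. q \<in> M \<and> q $ 3 = c)" for c
  have F: "F p = \<psi> (p $ 3)" if "p \<in> M" for p
  proof -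
    define q where "q = (SOME q. q \<in> M \<and> q $ 3 = p $ 3)"
    have "q \<in> M \<and> q $ 3 = p $ 3"
      unfolding q_def by (rule someI[of _ p]) (use that in simp)
    moreover have "\<psi> (p $ 3) = F q" by (simp add: \<psi>_def q_def)
    ultimately show ?thesis
      using constant_on_z_slices[OF assms(1,2) smooth_on_differentiable[OF assms(3)] assms(4,5), of p q]
        that by simp
  qed
  have sm: "smooth_on M (\<lambda>p. \<psi> (p $ 3))"
    by (rule smooth_on_cong[OF assms(3,1)]) (rule F)
  have "deriv \<psi> (p $ 3) = partial 3 F p" if "p \<in> M" for p
  proof -
    have 1: "(\<psi> has_real_derivative partial 3 (\<lambda>q. \<psi> (q $ 3)) p) (at (p $ 3))"
      using z_has_derivative smooth_on_differentiable[OF sm that] by blast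
    have "partial 3 F p = partial 3 (\<lambda>q. \<psi> (q $ 3)) p"
    proof (rule partial_eqI[OF assms(1) that smooth_on_differentiable[OF assms(3) that]])
      show "((\<lambda>t. \<psi> ((p + t *\<^sub>R axis 3 1) $ 3)) has_real_derivative
          partial 3 (\<lambda>q. \<psi> (q $ 3)) p) (at 0)"
        using has_derivative_coordinate_line[of "\<lambda>q. \<psi> (q $ 3)" p 0 3]
          smooth_on_differentiable[OF sm that] by simp
    qed (rule F)
    then show ?thesis using DERIV_imp_deriv[OF 1] by simp
  qed
  moreover have "smooth_on ((\<lambda>p. p $ 3) ` M) \<psi>"
    using sm Ck_on_z_descend[OF assms(1)] by (simp add: smooth_on_def)
  ultimately show thesis using F that by blast
qed

section \<open>The paracontact metric condition as a system of differential equations\<close>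

text \<open>After renaming the summation indices, both covariant derivatives carry the same
  Christoffel term, by symmetry in the lower indices. It cancels, so the inverse of the metric never
  has to be computed.\<close>

lemma ext_deriv_torsion_free:
  assumes "\<And>q. transpose (G q) = G q"
  shows "ext_deriv G \<omega> p X Y =
    (1/2) * (\<Sum>i\<in>UNIV. \<Sum>j\<in>UNIV. X $ i * Y $ j *
      (partial i (\<lambda>q. \<omega> q $ j) p - partial j (\<lambda>q. \<omega> q $ i) p))"
proof -
  have "cov_deriv_form G \<omega> p Y X = (\<Sum>i\<in>UNIV. \<Sum>j\<in>UNIV. X $ i * Y $ j *
        (partial j (\<lambda>q. \<omega> q $ i) p - (\<Sum>k\<in>UNIV. christoffel G k i j p * \<omega> p $ k)))"
    unfolding cov_deriv_form_def
    by (subst sum.swap, subst christoffel_torsion_free[OF assms]) (simp only: mult.commute)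
  then show ?thesis
    unfolding ext_deriv_def cov_deriv_form_def
    by (simp add: sum_subtractf[symmetric] right_diff_distrib[symmetric])
qed

lemma transpose_walker_metric: "transpose (walker_metric f q) = walker_metric f q"
  by (simp add: walker_metric_def transpose_def vec_eq_iff forall_3)

lemma fundamental_form_components:
  "fundamental_form f \<xi>1 \<xi>2 \<xi>3 p X Y =
    \<xi>3 p * (X $ 1 * Y $ 2 - X $ 2 * Y $ 1) - \<xi>2 p * (X $ 1 * Y $ 3 - X $ 3 * Y $ 1)
    + \<xi>1 p * (X $ 2 * Y $ 3 - X $ 3 * Y $ 2)"
  by (simp add: fundamental_form_def walker_phi_def walker_metric_def matrix_vector_mult_def
      inner_vec_def sum_3 algebra_simps)

text \<open>Both sides are alternating bilinear forms, so it suffices to compare them on the three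
  pairs of coordinate vectors. The factors 2 on the right stem from the factor 1/2 in
  \<open>ext_deriv\<close>.\<close>

lemma paracontact_point_iff:
  "(\<forall>X Y. fundamental_form f \<xi>1 \<xi>2 \<xi>3 p X Y =
      ext_deriv (walker_metric f) (walker_eta f \<xi>1 \<xi>2 \<xi>3) p X Y) \<longleftrightarrow>
    partial 1 \<xi>2 p - partial 2 \<xi>3 p = 2 * \<xi>3 p \<and>
    partial 1 (\<lambda>q. \<xi>1 q + f q * \<xi>3 q) p - partial 3 \<xi>3 p = - 2 * \<xi>2 p \<and>
    partial 2 (\<lambda>q. \<xi>1 q + f q * \<xi>3 q) p - partial 3 \<xi>2 p = 2 * \<xi>1 p"
  (is "?L \<longleftrightarrow> ?R")
proof
  let ?h = "\<lambda>q. \<xi>1 q + f q * \<xi>3 q"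
  have d: "ext_deriv (walker_metric f) (walker_eta f \<xi>1 \<xi>2 \<xi>3) p X Y =
      (1/2) * ((X $ 1 * Y $ 2 - X $ 2 * Y $ 1) * (partial 1 \<xi>2 p - partial 2 \<xi>3 p)
        + (X $ 1 * Y $ 3 - X $ 3 * Y $ 1) * (partial 1 ?h p - partial 3 \<xi>3 p)
        + (X $ 2 * Y $ 3 - X $ 3 * Y $ 2) * (partial 2 ?h p - partial 3 \<xi>2 p))" for X Y
    by (simp add: ext_deriv_torsion_free[OF transpose_walker_metric] walker_eta_def sum_3 algebra_simps)
  {
    assume ?L
    from this[rule_format, of "axis 1 1" "axis 2 1"] this[rule_format, of "axis 1 1" "axis 3 1"]
      this[rule_format, of "axis 2 1" "axis 3 1"]
    show ?R unfolding fundamental_form_components d by (simp add: axis_def)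
  next
    assume ?R
    then have e: "partial 1 \<xi>2 p - partial 2 \<xi>3 p = 2 * \<xi>3 p"
      "partial 1 ?h p - partial 3 \<xi>3 p = - 2 * \<xi>2 p"
      "partial 2 ?h p - partial 3 \<xi>2 p = 2 * \<xi>1 p" by auto
    show ?L unfolding fundamental_form_components d e by (simp add: field_simps)
  }
qed

lemma partial_constraint:
  assumes "open M" "p \<in> M" "\<And>q. q \<in> M \<Longrightarrow> f q * (a q)\<^sup>2 + 2 * b q * a q = (1::real)"
    and d: "f differentiable (at p)" "a differentiable (at p)" "b differentiable (at p)"
  shows "partial i f p * (a p)\<^sup>2 + 2 * f p * a p * partial i a p
    + 2 * partial i b p * a p + 2 * b p * partial i a p = 0"
proof -
  \<comment> \<open>The constraint is factored into sums and products of functions, the shape that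
    \<open>partial_add\<close> and \<open>partial_mult\<close> handle.\<close>
  have "partial i (\<lambda>q. (f q * a q + (b q + b q)) * a q) p = 0"
    by (rule partial_const_on[OF assms(1,2)])
      (use assms(3) d in \<open>auto simp: power2_eq_square algebra_simps\<close>)
  then show ?thesis
    using d partial_const_on[of UNIV p "\<lambda>_. 2" 2 i]
    by (simp add: partial_mult partial_add power2_eq_square algebra_simps)
qed

lemma paracontact_metric_iff:
  assumes W: "almost_paracontact_walker M f \<xi>1 \<xi>2 \<xi>3" and z: "\<forall>p\<in>M. \<xi>2 p = 0"
  shows "paracontact_metric M f \<xi>1 \<xi>2 \<xi>3 \<longleftrightarrow>
    (\<forall>p\<in>M. partial 2 \<xi>3 p = - 2 * \<xi>3 p \<and> partial 2 f p = 0 \<and>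
      partial 1 f p * (\<xi>3 p)\<^sup>2 - 2 * \<xi>1 p * partial 1 \<xi>3 p = 2 * \<xi>3 p * partial 3 \<xi>3 p)"
  unfolding paracontact_metric_def paracontact_point_iff
proof (rule ball_cong[OF refl])
  fix p assume p: "p \<in> M"
  have M: "open M" and d: "f differentiable (at p)" "\<xi>1 differentiable (at p)"
    "\<xi>2 differentiable (at p)" "\<xi>3 differentiable (at p)"
    using W p by (auto simp: almost_paracontact_walker_def intro: smooth_on_differentiable)
  have c: "f q * (\<xi>3 q)\<^sup>2 + 2 * \<xi>1 q * \<xi>3 q = 1" if "q \<in> M" for q
    using W z that by (auto simp: almost_paracontact_walker_def)
  have z': "partial i \<xi>2 p = 0" for i
    by (rule partial_const_on[OF M p d(3)]) (use z in auto)
  have h: "partial i (\<lambda>q. \<xi>1 q + f q * \<xi>3 q) p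
      = partial i \<xi>1 p + partial i f p * \<xi>3 p + f p * partial i \<xi>3 p" for i
    using d by (simp add: partial_add partial_mult)
  have C: "partial i f p * (\<xi>3 p)\<^sup>2 + 2 * f p * \<xi>3 p * partial i \<xi>3 p
      + 2 * partial i \<xi>1 p * \<xi>3 p + 2 * \<xi>1 p * partial i \<xi>3 p = 0" for i
    by (rule partial_constraint[OF M p c d(1,4,2)])
  \<comment> \<open>If \<open>\<xi>3 p\<close> were 0, the constraint would read 0 = 1.\<close>
  have a: "\<xi>3 p \<noteq> 0" using c[OF p] by auto
  \<comment> \<open>Given the equation for \<open>partial 2 \<xi>3\<close>, the constraint
    differentiated in \<open>y\<close> removes \<open>partial 2 \<xi>1\<close>. What remains of the
    (2,3) component is a multiple of \<open>partial 2 f\<close>.\<close>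
  have b2: "2 * (partial 2 \<xi>1 p + partial 2 f p * \<xi>3 p + f p * partial 2 \<xi>3 p - 2 * \<xi>1 p)
      = partial 2 f p * \<xi>3 p"
    if "partial 2 \<xi>3 p = - 2 * \<xi>3 p"
  proof -
    have "\<xi>3 p * (2 * (partial 2 \<xi>1 p + partial 2 f p * \<xi>3 p + f p * partial 2 \<xi>3 p - 2 * \<xi>1 p))
        = \<xi>3 p * (partial 2 f p * \<xi>3 p)"
      using C[of 2] unfolding that by (simp add: power2_eq_square algebra_simps)
    then show ?thesis using a by simp
  qed
  \<comment> \<open>Likewise the constraint differentiated in \<open>x\<close> removes
    \<open>partial 1 \<xi>1\<close> from the (1,3) component.\<close>
  have b1: "2 * \<xi>3 p * (partial 1 \<xi>1 p + partial 1 f p * \<xi>3 p + f p * partial 1 \<xi>3 p)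
      = partial 1 f p * (\<xi>3 p)\<^sup>2 - 2 * \<xi>1 p * partial 1 \<xi>3 p"
    using C[of 1] by (simp add: power2_eq_square algebra_simps)
  have b1': "partial 1 \<xi>1 p + partial 1 f p * \<xi>3 p + f p * partial 1 \<xi>3 p = partial 3 \<xi>3 p \<longleftrightarrow>
      partial 1 f p * (\<xi>3 p)\<^sup>2 - 2 * \<xi>1 p * partial 1 \<xi>3 p = 2 * \<xi>3 p * partial 3 \<xi>3 p"
    using a by (simp flip: b1)
  have b2': "partial 2 \<xi>1 p + partial 2 f p * \<xi>3 p + f p * partial 2 \<xi>3 p = 2 * \<xi>1 p \<longleftrightarrow>
      partial 2 f p = 0"
    if "partial 2 \<xi>3 p = - 2 * \<xi>3 p"
    using b2[OF that] a by (metis eq_iff_diff_eq_0 mult_eq_0_iff zero_neq_numeral)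
  have "partial 2 \<xi>3 p = - 2 * \<xi>3 p \<longleftrightarrow> - partial 2 \<xi>3 p = 2 * \<xi>3 p" by auto
  then show "(partial 1 \<xi>2 p - partial 2 \<xi>3 p = 2 * \<xi>3 p \<and>
      partial 1 (\<lambda>q. \<xi>1 q + f q * \<xi>3 q) p - partial 3 \<xi>3 p = - 2 * \<xi>2 p \<and>
      partial 2 (\<lambda>q. \<xi>1 q + f q * \<xi>3 q) p - partial 3 \<xi>2 p = 2 * \<xi>1 p) \<longleftrightarrow>
    (partial 2 \<xi>3 p = - 2 * \<xi>3 p \<and> partial 2 f p = 0 \<and>
      partial 1 f p * (\<xi>3 p)\<^sup>2 - 2 * \<xi>1 p * partial 1 \<xi>3 p = 2 * \<xi>3 p * partial 3 \<xi>3 p)"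
    using b1' b2' z p by (auto simp: h z')
qed

section \<open>Normal form\<close>

text \<open>The linear equation makes \<open>h\<close> exponential along every line in direction
  \<open>j\<close>. Since the range of \<open>t\<close> is uniform near \<open>p\<close>, the
  translate of \<open>h\<close> by \<open>t\<close> equals \<open>exp (c * t)\<close> times
  \<open>h\<close> on a whole ball, and all its partial derivatives scale alike. Second derivatives
  of \<open>h\<close> are thus avoided.\<close>

lemma partial_scaling:
  assumes "open M" "p \<in> M"
    and h: "\<forall>q\<in>M. h differentiable (at q) \<and> partial j h q = c * h q"
  shows "\<forall>\<^sub>F t in nhds 0. p + t *\<^sub>R axis j 1 \<in> M \<and> h (p + t *\<^sub>R axis j 1) = exp (c * t) * h p \<and>
    (\<forall>i. partial i h (p + t *\<^sub>R axis j 1) = exp (c * t) * partial i h p)"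
proof -
  \<comment> \<open>The radius is doubled so that points of \<open>ball p d\<close> stay in
    \<open>M\<close> when moved by less than \<open>d\<close>.\<close>
  obtain d where d: "d > 0" "ball p (2 * d) \<subseteq> M"
    using openE[OF assms(1,2)] by (metis half_gt_zero field_sum_of_halves mult_2)
  have near: "q + t *\<^sub>R axis j 1 \<in> M" if "q \<in> ball p d" "\<bar>t\<bar> < d" for q t
  proof -
    have "dist p (q + t *\<^sub>R axis j 1) \<le> dist p q + dist q (q + t *\<^sub>R axis j 1)"
      by (rule dist_triangle)
    also have "\<dots> < 2 * d"
      using that by (simp add: dist_norm)
    finally show ?thesis using d(2) by auto
  qed
  have scale: "h (q + t *\<^sub>R axis j 1) = exp (c * t) * h q" if q: "q \<in> ball p d" and t: "\<bar>t\<bar> < d" for q t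
  proof -
    \<comment> \<open>Integrating factor: \<open>exp (- c * t)\<close> times the solution is
      constant.\<close>
    have "((\<lambda>t. exp (- c * t) * h (q + t *\<^sub>R axis j 1)) has_real_derivative 0) (at s within {-d<..<d})"
      if "s \<in> {-d<..<d}" for s
    proof -
      have s: "q + s *\<^sub>R axis j 1 \<in> M" using near[OF q] that by auto
      show ?thesis
        by (rule has_field_derivative_at_within)
          (auto intro!: derivative_eq_intros has_derivative_coordinate_line
            simp: h s)
    qed
    then obtain k where k: "\<And>s. s \<in> {-d<..<d} \<Longrightarrow> exp (- c * s) * h (q + s *\<^sub>R axis j 1) = k"
      using has_field_derivative_zero_constant[of "{-d<..<d}"
          "\<lambda>t. exp (- c * t) * h (q + t *\<^sub>R axis j 1)"] by auto
    have "exp (- (c * t)) * h (q + t *\<^sub>R axis j 1) = h q"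
      using k[of t] k[of 0] t d(1) by (simp add: abs_less_iff)
    then show ?thesis
      by (simp add: exp_minus field_simps)
  qed
  have part: "partial i h (p + t *\<^sub>R axis j 1) = exp (c * t) * partial i h p" if t: "\<bar>t\<bar> < d" for i t
  proof -
    have pM: "p + t *\<^sub>R axis j 1 \<in> M" using near[OF _ t] d(1) by simp
    show ?thesis
    proof (rule partial_eqI[of "(+) (t *\<^sub>R axis j 1) ` ball p d"])
      show "open ((+) (t *\<^sub>R axis j 1) ` ball p d)" by (rule open_translation) simp
      show "p + t *\<^sub>R axis j 1 \<in> (+) (t *\<^sub>R axis j 1) ` ball p d" using d(1) by (simp add: add.commute)
      show "h differentiable (at (p + t *\<^sub>R axis j 1))" using h pM by blast
      show "h (p + t *\<^sub>R axis j 1 + s *\<^sub>R axis i 1) = exp (c * t) * h (p + s *\<^sub>R axis i 1)"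
        if s: "p + t *\<^sub>R axis j 1 + s *\<^sub>R axis i 1 \<in> (+) (t *\<^sub>R axis j 1) ` ball p d" for s
      proof -
        have "p + s *\<^sub>R axis i 1 \<in> ball p d"
          using s by (auto simp: image_iff algebra_simps)
        from scale[OF this t] show ?thesis by (simp add: algebra_simps)
      qed
      show "((\<lambda>s. exp (c * t) * h (p + s *\<^sub>R axis i 1)) has_real_derivative exp (c * t) * partial i h p) (at 0)"
        using has_derivative_coordinate_line[of h p 0 i] assms(2) h by (simp add: DERIV_cmult)
    qed
  qed
  have "\<forall>\<^sub>F t in nhds 0. \<bar>t\<bar> < d"
    using d(1) by (auto simp: eventually_nhds_metric dist_real_def)
  then show ?thesis
    by (rule eventually_mono) (use near scale part d(1) in auto)
qed

text \<open>Multiplying the third equation by \<open>\<xi>3\<close> and eliminating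
  \<open>\<xi>1\<close> gives \<open>E'\<close>. Under a shift by \<open>t\<close> in
  \<open>y\<close> its left side scales by \<open>exp (- 6 * t)\<close> and its right side by
  \<open>exp (- 2 * t)\<close>, which forces both to vanish.\<close>

lemma paracontact_partial_x_zero:
  assumes W: "almost_paracontact_walker M f \<xi>1 \<xi>2 \<xi>3" and z: "\<forall>p\<in>M. \<xi>2 p = 0"
    and P: "paracontact_metric M f \<xi>1 \<xi>2 \<xi>3" and p: "p \<in> M"
  shows "partial 1 \<xi>3 p = 0"
proof -
  have M: "open M" and d: "\<And>q. q \<in> M \<Longrightarrow> f differentiable (at q)"
    "\<And>q. q \<in> M \<Longrightarrow> \<xi>3 differentiable (at q)"
    using W by (auto simp: almost_paracontact_walker_def intro: smooth_on_differentiable)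
  have c: "f q * (\<xi>3 q)\<^sup>2 + 2 * \<xi>1 q * \<xi>3 q = 1" if "q \<in> M" for q
    using W z that by (auto simp: almost_paracontact_walker_def)
  \<comment> \<open>The zero is written \<open>0 * f q\<close> so that
    \<open>partial_scaling\<close> applies to \<open>f\<close> with \<open>c = 0\<close>.\<close>
  have E: "partial 2 \<xi>3 q = - 2 * \<xi>3 q" "partial 2 f q = 0 * f q"
    "partial 1 f q * (\<xi>3 q)\<^sup>2 - 2 * \<xi>1 q * partial 1 \<xi>3 q = 2 * \<xi>3 q * partial 3 \<xi>3 q"
    if "q \<in> M" for q
    using P that by (auto simp: paracontact_metric_iff[OF W z])
  have E': "partial 1 f q * (\<xi>3 q)^3 + f q * (\<xi>3 q)\<^sup>2 * partial 1 \<xi>3 q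
      - 2 * (\<xi>3 q)\<^sup>2 * partial 3 \<xi>3 q = partial 1 \<xi>3 q" if "q \<in> M" for q
  proof -
    have "partial 1 f q * (\<xi>3 q)^3 - (2 * \<xi>1 q * \<xi>3 q) * partial 1 \<xi>3 q
        = 2 * (\<xi>3 q)\<^sup>2 * partial 3 \<xi>3 q"
      using arg_cong[OF E(3)[OF that], of "\<lambda>u. u * \<xi>3 q"]
      by (simp add: power2_eq_square power3_eq_cube algebra_simps)
    moreover have "2 * \<xi>1 q * \<xi>3 q = 1 - f q * (\<xi>3 q)\<^sup>2" using c[OF that] by simp
    ultimately show ?thesis by (simp add: left_diff_distrib)
  qed
  have s: "\<forall>q\<in>M. \<xi>3 differentiable (at q) \<and> partial 2 \<xi>3 q = - 2 * \<xi>3 q"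
    "\<forall>q\<in>M. f differentiable (at q) \<and> partial 2 f q = 0 * f q"
    using d E(1,2) by auto
  have "\<forall>\<^sub>F t in nhds 0. partial 1 \<xi>3 p = exp (- 4 * t) * partial 1 \<xi>3 p"
    using partial_scaling[OF M p s(1)] partial_scaling[OF M p s(2)]
  proof eventually_elim
    case (elim t)
    let ?q = "p + t *\<^sub>R axis 2 1" and ?e = "exp (- 2 * t)"
    have "?e^3 * (partial 1 f p * (\<xi>3 p)^3 + f p * (\<xi>3 p)\<^sup>2 * partial 1 \<xi>3 p
        - 2 * (\<xi>3 p)\<^sup>2 * partial 3 \<xi>3 p) = ?e * partial 1 \<xi>3 p"
      using E'[of ?q] elim by (simp add: power2_eq_square power3_eq_cube algebra_simps)
    then have "?e * (?e^2 * partial 1 \<xi>3 p) = ?e * partial 1 \<xi>3 p"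
      unfolding E'[OF p] by (simp add: power2_eq_square power3_eq_cube algebra_simps)
    then have "?e^2 * partial 1 \<xi>3 p = partial 1 \<xi>3 p" by simp
    moreover have "?e^2 = exp (- 4 * t)" by (simp flip: exp_of_nat_mult)
    ultimately show ?case by simp
  qed
  then obtain r where r: "r > 0" "\<And>t. \<bar>t\<bar> < r \<Longrightarrow> partial 1 \<xi>3 p = exp (- 4 * t) * partial 1 \<xi>3 p"
    unfolding eventually_nhds_metric dist_real_def by (metis diff_zero)
  \<comment> \<open>At a nonzero \<open>t\<close> the factor \<open>exp (- 4 * t)\<close> differs
    from 1.\<close>
  from r(2)[of "r / 2"] r(1) show ?thesis by auto
qed

section \<open>Restriction to open subsets and the two implications for the normal form\<close>

lemma almost_paracontact_walker_subset:
  "almost_paracontact_walker M f \<xi>1 \<xi>2 \<xi>3 \<Longrightarrow> open U \<Longrightarrow> U \<subseteq> M \<Longrightarrow> almost_paracontact_walker U f \<xi>1 \<xi>2 \<xi>3"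
  unfolding almost_paracontact_walker_def using smooth_on_subset by blast

lemma paracontact_metric_subset:
  "paracontact_metric M f \<xi>1 \<xi>2 \<xi>3 \<Longrightarrow> U \<subseteq> M \<Longrightarrow> paracontact_metric U f \<xi>1 \<xi>2 \<xi>3"
  unfolding paracontact_metric_def by blast

text \<open>Direct substitution into the system. It contains no \<open>partial 3 f\<close>, and
  lines in \<open>x\<close> and \<open>y\<close> keep \<open>z\<close> fixed, so
  \<open>deriv \<psi>\<close> and \<open>m\<close> are never differentiated.\<close>

lemma signed_normal_form_imp_paracontact:
  assumes W: "almost_paracontact_walker M f \<xi>1 \<xi>2 \<xi>3" and z: "\<forall>p\<in>M. \<xi>2 p = 0"
    and N: "signed_normal_form \<epsilon> M f \<xi>3"
  shows "paracontact_metric M f \<xi>1 \<xi>2 \<xi>3"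
  unfolding paracontact_metric_iff[OF W z]
proof
  fix p assume p: "p \<in> M"
  have M: "open M" and d: "f differentiable (at p)" "\<xi>3 differentiable (at p)"
    using W p by (auto simp: almost_paracontact_walker_def intro: smooth_on_differentiable)
  obtain \<psi> m where \<psi>: "smooth_on ((\<lambda>p. p $ 3) ` M) \<psi>"
    and a: "\<And>q. q \<in> M \<Longrightarrow> \<xi>3 q = \<epsilon> * exp (- 2 * q $ 2 + \<psi> (q $ 3))"
    and f: "\<And>q. q \<in> M \<Longrightarrow> f q = 2 * deriv \<psi> (q $ 3) * q $ 1 + m (q $ 3)"
    using N unfolding signed_normal_form_def by blast
  have "\<psi> differentiable (at (p $ 3))" using smooth_on_differentiable[OF \<psi>] p by blast
  then have "(\<psi> has_real_derivative deriv \<psi> (p $ 3)) (at (p $ 3 + 0))"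
    by (simp add: DERIV_deriv_iff_real_differentiable)
  then have \<psi>': "((\<lambda>t. \<psi> (p $ 3 + t)) has_real_derivative deriv \<psi> (p $ 3)) (at 0)"
    using DERIV_shift[of \<psi> _ 0 "p $ 3"] by (simp add: add.commute)
  have "partial 1 \<xi>3 p = 0"
    by (rule partial_eqI[OF M p d(2) a]) (auto simp: axis_def)
  moreover have "partial 2 \<xi>3 p = - 2 * \<xi>3 p"
    by (rule partial_eqI[OF M p d(2) a]) (auto simp: axis_def a[OF p] intro!: derivative_eq_intros)
  moreover have "partial 3 \<xi>3 p = deriv \<psi> (p $ 3) * \<xi>3 p"
    by (rule partial_eqI[OF M p d(2) a]) (auto simp: axis_def a[OF p] intro!: derivative_eq_intros \<psi>')
  moreover have "partial 1 f p = 2 * deriv \<psi> (p $ 3)"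
    by (rule partial_eqI[OF M p d(1) f]) (auto simp: axis_def intro!: derivative_eq_intros)
  moreover have "partial 2 f p = 0"
    by (rule partial_eqI[OF M p d(1) f]) (auto simp: axis_def)
  ultimately show "partial 2 \<xi>3 p = - 2 * \<xi>3 p \<and> partial 2 f p = 0 \<and>
      partial 1 f p * (\<xi>3 p)\<^sup>2 - 2 * \<xi>1 p * partial 1 \<xi>3 p = 2 * \<xi>3 p * partial 3 \<xi>3 p"
    by (simp add: power2_eq_square)
qed

text \<open>The sign makes a logarithm of \<open>\<epsilon> * \<xi>3\<close> available. Connected
  slices then turn first \<open>\<Psi>\<close> and afterwards \<open>F\<close> into functions of
  \<open>z\<close> on all of \<open>M\<close>.\<close>

lemma paracontact_imp_signed_normal_form:
  assumes W: "almost_paracontact_walker M f \<xi>1 \<xi>2 \<xi>3" and z: "\<forall>p\<in>M. \<xi>2 p = 0"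
    and P: "paracontact_metric M f \<xi>1 \<xi>2 \<xi>3" and S: "z_slices_connected M"
    and \<epsilon>: "\<epsilon> \<in> {1, -1}" and pos: "\<And>p. p \<in> M \<Longrightarrow> \<epsilon> * \<xi>3 p > 0"
  shows "signed_normal_form \<epsilon> M f \<xi>3"
proof -
  have M: "open M" and sf: "smooth_on M f" and sa: "smooth_on M \<xi>3"
    using W by (auto simp: almost_paracontact_walker_def)
  have E: "partial 1 \<xi>3 p = 0" "partial 2 \<xi>3 p = - 2 * \<xi>3 p" "partial 2 f p = 0"
    "partial 1 f p * \<xi>3 p = 2 * partial 3 \<xi>3 p" if p: "p \<in> M" for p
  proof -
    have "\<xi>3 p \<noteq> 0" using pos[OF p] by auto
    moreover have "\<xi>3 p * (partial 1 f p * \<xi>3 p) = \<xi>3 p * (2 * partial 3 \<xi>3 p)"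
      using bspec[OF P[unfolded paracontact_metric_iff[OF W z]] p] paracontact_partial_x_zero[OF W z P p]
      by (simp add: power2_eq_square mult_ac)
    ultimately show "partial 1 f p * \<xi>3 p = 2 * partial 3 \<xi>3 p" by simp
  qed (use P p paracontact_partial_x_zero[OF W z P p] in \<open>auto simp: paracontact_metric_iff[OF W z]\<close>)
  define \<Psi> where "\<Psi> p = ln (\<epsilon> * \<xi>3 p) + 2 * p $ 2" for p :: "real^3"
  have s\<Psi>: "smooth_on M \<Psi>"
    unfolding smooth_on_def \<Psi>_def
    using sa pos
    by (intro allI Ck_on_add[OF M] Ck_on_ln[OF M] Ck_on_mult[OF M] Ck_on_const[OF M]
        Ck_on_linear[OF M bounded_linear_vec_nth]) (auto simp: smooth_on_def)
  \<comment> \<open>The sign cancels in the logarithmic derivative; the last summand is 2 for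
    \<open>i = 2\<close> and 0 otherwise.\<close>
  have p\<Psi>: "partial i \<Psi> p = partial i \<xi>3 p / \<xi>3 p + 2 * axis i 1 $ 2" if p: "p \<in> M" for i p
  proof (rule partial_eqI[OF M p smooth_on_differentiable[OF s\<Psi> p] \<Psi>_def])
    have "\<epsilon> * \<xi>3 (p + 0 *\<^sub>R axis i 1) > 0" using pos[OF p] by simp
    moreover have "((\<lambda>t. \<xi>3 (p + t *\<^sub>R axis i 1)) has_real_derivative partial i \<xi>3 p) (at 0)"
      using has_derivative_coordinate_line[of \<xi>3 p 0 i] smooth_on_differentiable[OF sa p] by simp
    ultimately show "((\<lambda>t. ln (\<epsilon> * \<xi>3 (p + t *\<^sub>R axis i 1)) + 2 * (p + t *\<^sub>R axis i 1) $ 2)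
        has_real_derivative partial i \<xi>3 p / \<xi>3 p + 2 * axis i 1 $ 2) (at 0)"
      using \<epsilon> by (auto intro!: derivative_eq_intros)
  qed
  obtain \<psi> where \<psi>: "smooth_on ((\<lambda>p. p $ 3) ` M) \<psi>" "\<And>p. p \<in> M \<Longrightarrow> \<Psi> p = \<psi> (p $ 3)"
    "\<And>p. p \<in> M \<Longrightarrow> deriv \<psi> (p $ 3) = partial 3 \<Psi> p"
    by (rule smooth_function_of_z[OF M S s\<Psi>]) (use pos in \<open>force simp: p\<Psi> E axis_def\<close>)+
  \<comment> \<open>Written with \<open>partial 3 \<Psi>\<close>, \<open>F\<close> is visibly smooth
    on \<open>M\<close>. The form with \<open>deriv \<psi>\<close>, stated next, shows that the
    coefficient of \<open>x\<close> is constant along lines in \<open>x\<close> and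
    \<open>y\<close>.\<close>
  define F where "F p = f p + (- 2) * (partial 3 \<Psi> p * p $ 1)" for p
  have sF: "smooth_on M F"
    unfolding smooth_on_def F_def
    using sf smooth_on_frechet_derivative[OF s\<Psi>, of "axis 3 1"]
    by (intro allI Ck_on_add[OF M] Ck_on_mult[OF M] Ck_on_const[OF M]
        Ck_on_linear[OF M bounded_linear_vec_nth]) (auto simp: smooth_on_def partial_def)
  have F: "F q = f q - 2 * deriv \<psi> (q $ 3) * q $ 1" if "q \<in> M" for q
    using \<psi>(3)[OF that] by (simp add: F_def)
  have "partial 1 F p = 0" if p: "p \<in> M" for p
  proof (rule partial_eqI[OF M p smooth_on_differentiable[OF sF p] F])
    have "partial 1 f p = 2 * deriv \<psi> (p $ 3)"
      using E(4)[OF p] pos[OF p] by (cases "\<xi>3 p = 0") (simp_all add: \<psi>(3) p p\<Psi> axis_def field_simps)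
    then show "((\<lambda>t. f (p + t *\<^sub>R axis 1 1) - 2 * deriv \<psi> ((p + t *\<^sub>R axis 1 1) $ 3) *
        (p + t *\<^sub>R axis 1 1) $ 1) has_real_derivative 0) (at 0)"
      using has_derivative_coordinate_line[of f p 0 1] smooth_on_differentiable[OF sf p]
      by (auto simp: axis_def intro!: derivative_eq_intros)
  qed
  moreover have "partial 2 F p = 0" if p: "p \<in> M" for p
  proof (rule partial_eqI[OF M p smooth_on_differentiable[OF sF p] F])
    show "((\<lambda>t. f (p + t *\<^sub>R axis 2 1) - 2 * deriv \<psi> ((p + t *\<^sub>R axis 2 1) $ 3) *
        (p + t *\<^sub>R axis 2 1) $ 1) has_real_derivative 0) (at 0)"
      using has_derivative_coordinate_line[of f p 0 2] smooth_on_differentiable[OF sf p] E(3)[OF p]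
      by (auto simp: axis_def intro!: derivative_eq_intros)
  qed
  ultimately obtain m where m: "smooth_on ((\<lambda>p. p $ 3) ` M) m" "\<And>p. p \<in> M \<Longrightarrow> F p = m (p $ 3)"
    using smooth_function_of_z[OF M S sF] by blast
  have "\<xi>3 p = \<epsilon> * exp (- 2 * p $ 2 + \<psi> (p $ 3))" if p: "p \<in> M" for p
  proof -
    have "exp (- 2 * p $ 2 + \<psi> (p $ 3)) = \<epsilon> * \<xi>3 p"
      using pos[OF p] by (simp add: \<psi>(2)[OF p, symmetric] \<Psi>_def)
    then show ?thesis using \<epsilon> by auto
  qed
  moreover have "f p = 2 * deriv \<psi> (p $ 3) * p $ 1 + m (p $ 3)" if p: "p \<in> M" for p
    using F[OF p] m(2)[OF p] by simp
  ultimately show ?thesis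
    unfolding signed_normal_form_def using \<psi>(1) m(1) by blast
qed

section \<open>The sign of \<open>\<xi>3\<close> and the global and local equivalences\<close>

text \<open>The constraint keeps \<open>\<xi>3\<close> away from 0, so by the intermediate value
  theorem it cannot take both signs on a connected set.\<close>

lemma walker_xi3_sign:
  assumes W: "almost_paracontact_walker M f \<xi>1 \<xi>2 \<xi>3" and z: "\<forall>p\<in>M. \<xi>2 p = 0"
    and "connected M"
  shows "\<exists>\<epsilon>\<in>{1, -1}. \<forall>p\<in>M. \<epsilon> * \<xi>3 p > 0"
proof (rule ccontr)
  have nz: "\<xi>3 p \<noteq> 0" if "p \<in> M" for p
    using W z that by (auto simp: almost_paracontact_walker_def)
  assume "\<not> ?thesis"
  then obtain p q where pq: "p \<in> M" "q \<in> M" "\<xi>3 p < 0" "\<xi>3 q > 0"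
    using nz by (force simp: not_less order_le_less)
  have "continuous_on M \<xi>3"
    using W by (metis almost_paracontact_walker_def smooth_on_def Ck_on.simps(1))
  then have "connected (\<xi>3 ` M)" using \<open>connected M\<close> by (rule connected_continuous_image)
  then have "0 \<in> \<xi>3 ` M" using pq by (auto intro: connectedD_interval[of _ "\<xi>3 p" "\<xi>3 q"])
  then show False using nz by force
qed

lemma z_slices_connected_convex: "convex M \<Longrightarrow> z_slices_connected M"
  unfolding z_slices_connected_def
proof
  fix c assume "convex M"
  have "convex {p::real^3. p $ 3 = c}"
    by (auto simp: convex_def simp flip: distrib_right)
  then have "convex (M \<inter> {p. p $ 3 = c})" using \<open>convex M\<close> by (simp add: convex_Int)
  then show "connected {p \<in> M. p $ 3 = c}" by (simp add: Int_def convex_connected)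
qed

theorem theorem4p2:
  fixes M :: "(real^3) set" and f \<xi>1 \<xi>2 \<xi>3 :: "real^3 \<Rightarrow> real"
  assumes "almost_paracontact_walker M f \<xi>1 \<xi>2 \<xi>3"
    and "\<forall>p\<in>M. \<xi>2 p = 0"
  shows "(z_slices_connected M \<and> (\<forall>p\<in>M. \<xi>3 p > 0) \<longrightarrow>
      (paracontact_metric M f \<xi>1 \<xi>2 \<xi>3 \<longleftrightarrow>
        (\<exists>\<psi> m. smooth_on ((\<lambda>p. p $ 3) ` M) \<psi> \<and> smooth_on ((\<lambda>p. p $ 3) ` M) m \<and>
          (\<forall>p\<in>M. \<xi>3 p = exp (- 2 * p $ 2 + \<psi> (p $ 3)) \<and>
                 f p = 2 * deriv \<psi> (p $ 3) * p $ 1 + m (p $ 3))))) \<and>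
    (z_slices_connected M \<and> connected M \<longrightarrow>
      (paracontact_metric M f \<xi>1 \<xi>2 \<xi>3 \<longleftrightarrow>
        (\<exists>\<epsilon>\<in>{1, -1}. signed_normal_form \<epsilon> M f \<xi>3))) \<and>
    (paracontact_metric M f \<xi>1 \<xi>2 \<xi>3 \<longleftrightarrow>
      (\<forall>p\<in>M. \<exists>U. open U \<and> p \<in> U \<and> U \<subseteq> M \<and>
        (\<exists>\<epsilon>\<in>{1, -1}. signed_normal_form \<epsilon> U f \<xi>3)))"
proof (intro conjI impI)
  note W = assms(1) and z = assms(2)
  have M: "open M" using W by (simp add: almost_paracontact_walker_def)
  {
    assume "z_slices_connected M \<and> (\<forall>p\<in>M. \<xi>3 p > 0)"
    then have "paracontact_metric M f \<xi>1 \<xi>2 \<xi>3 \<longleftrightarrow> signed_normal_form 1 M f \<xi>3"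
      using paracontact_imp_signed_normal_form[OF W z, of 1]
        signed_normal_form_imp_paracontact[OF W z, of 1] by auto
    then show "paracontact_metric M f \<xi>1 \<xi>2 \<xi>3 \<longleftrightarrow>
        (\<exists>\<psi> m. smooth_on ((\<lambda>p. p $ 3) ` M) \<psi> \<and> smooth_on ((\<lambda>p. p $ 3) ` M) m \<and>
          (\<forall>p\<in>M. \<xi>3 p = exp (- 2 * p $ 2 + \<psi> (p $ 3)) \<and>
                 f p = 2 * deriv \<psi> (p $ 3) * p $ 1 + m (p $ 3)))"
      by (simp only: signed_normal_form_def mult_1_left)
  next
    assume "z_slices_connected M \<and> connected M"
    then show "paracontact_metric M f \<xi>1 \<xi>2 \<xi>3 \<longleftrightarrow> (\<exists>\<epsilon>\<in>{1, -1}. signed_normal_form \<epsilon> M f \<xi>3)"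
      using paracontact_imp_signed_normal_form[OF W z] signed_normal_form_imp_paracontact[OF W z]
        walker_xi3_sign[OF W z] by meson
  next
    show "paracontact_metric M f \<xi>1 \<xi>2 \<xi>3 \<longleftrightarrow>
      (\<forall>p\<in>M. \<exists>U. open U \<and> p \<in> U \<and> U \<subseteq> M \<and> (\<exists>\<epsilon>\<in>{1, -1}. signed_normal_form \<epsilon> U f \<xi>3))"
    proof (intro iffI ballI)
      fix p assume P: "paracontact_metric M f \<xi>1 \<xi>2 \<xi>3" and "p \<in> M"
      \<comment> \<open>A ball is connected and, being convex, has connected slices, so the global
        argument applies to it.\<close>
      then obtain d where d: "d > 0" "ball p d \<subseteq> M" using openE[OF M] by blast
      have W': "almost_paracontact_walker (ball p d) f \<xi>1 \<xi>2 \<xi>3"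
        using almost_paracontact_walker_subset[OF W _ d(2)] by simp
      have z': "\<forall>q\<in>ball p d. \<xi>2 q = 0" using z d(2) by blast
      obtain \<epsilon> where "\<epsilon> \<in> {1, -1}" "\<forall>q\<in>ball p d. \<epsilon> * \<xi>3 q > 0"
        using walker_xi3_sign[OF W' z' connected_ball] by blast
      then have "signed_normal_form \<epsilon> (ball p d) f \<xi>3"
        by (intro paracontact_imp_signed_normal_form[OF W' z' paracontact_metric_subset[OF P d(2)]
              z_slices_connected_convex[OF convex_ball]]) auto
      then show "\<exists>U. open U \<and> p \<in> U \<and> U \<subseteq> M \<and> (\<exists>\<epsilon>\<in>{1, -1}. signed_normal_form \<epsilon> U f \<xi>3)"
        using d \<open>\<epsilon> \<in> {1, -1}\<close> by (intro exI[of _ "ball p d"]) auto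
    next
      assume L: "\<forall>p\<in>M. \<exists>U. open U \<and> p \<in> U \<and> U \<subseteq> M \<and> (\<exists>\<epsilon>\<in>{1, -1}. signed_normal_form \<epsilon> U f \<xi>3)"
      \<comment> \<open>The paracontact metric condition is pointwise, so it may be checked on the
        neighbourhoods separately, each with its own sign and functions.\<close>
      have "\<exists>U. p \<in> U \<and> paracontact_metric U f \<xi>1 \<xi>2 \<xi>3" if "p \<in> M" for p
      proof -
        obtain U \<epsilon> where U: "open U" "p \<in> U" "U \<subseteq> M" "signed_normal_form \<epsilon> U f \<xi>3"
          using L \<open>p \<in> M\<close> by blast
        have "\<forall>q\<in>U. \<xi>2 q = 0" using z U(3) by blast
        with U(2) show ?thesis
          using signed_normal_form_imp_paracontact[OF almost_paracontact_walker_subset[OF W U(1,3)] _ U(4)]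
          by (intro exI[of _ U] conjI)
      qed
      then show "paracontact_metric M f \<xi>1 \<xi>2 \<xi>3"
        unfolding paracontact_metric_def by blast
    qed
  }
qed

end
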